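(* Let $n\ge2$, $0\le m\le n$, $d=n-m$, and let $R$ be an $m\times n$ Latin rectangle with used column–symbol matrix $M$ and centred matrix $C=M-\frac mn\mathbf 1\mathbf 1^{\mathsf T}$. For distinct columns $a,b$ let $c_{ab}=|S_a\cap S_b|$, and let $\bar c=\frac{m(m-1)}{n-1}$. Then $$\operatorname{tr}\bigl((C^{\mathsf T}C)^2\bigr)=\sum_{a\ne b}(c_{ab}-\bar c)^2+\frac{m^2d^2}{n-1},$$ where the sum is over ordered pairs of distinct columns.
   Context: An $m\times n$ Latin rectangle is an $m\times n$ array with entries in $[n]=\{1,\dots,n\}$ such that every row is a permutation of $[n]$ and no symbol is repeated in a column. Its used column–symbol matrix is the $n\times n$ zero–one matrix $M$ with $M_{cs}=1$ iff symbol $s$ occurs in column $c$ of $R$. $S_c$ is the set of symbols occurring in column $c$. $\mathbf 1$ is the all-ones vector. *)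

theory Defs
  imports Complex_Main "Jordan_Normal_Form.Matrix"
begin

text \<open>
  Matrix rows and columns are indexed from 0, as usual for the type \<open>mat\<close>, whereas the
  entries of a Latin rectangle range over \<open>{1..n}\<close>. Hence symbol \<open>s\<close> labels the
  matrix column with index \<open>s - 1\<close>.
\<close>

definition latin_rectangle :: "nat \<Rightarrow> nat \<Rightarrow> nat mat \<Rightarrow> bool" where
  "latin_rectangle m n R \<longleftrightarrow>
     R \<in> carrier_mat m n \<and>
     (\<forall>r<m. bij_betw (\<lambda>c. R $$ (r, c)) {..<n} {1..n}) \<and>
     (\<forall>c<n. inj_on (\<lambda>r. R $$ (r, c)) {..<m})"

definition column_symbols :: "nat mat \<Rightarrow> nat \<Rightarrow> nat set" where
  "column_symbols R c = {R $$ (r, c) | r. r < dim_row R}"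

definition column_symbol_matrix :: "nat mat \<Rightarrow> real mat" where
  "column_symbol_matrix R =
     mat (dim_col R) (dim_col R) (\<lambda>(c, s). if Suc s \<in> column_symbols R c then 1 else 0)"

definition ones_col :: "nat \<Rightarrow> real mat" where
  "ones_col n = mat n 1 (\<lambda>_. 1)"

definition centred_matrix :: "nat mat \<Rightarrow> real mat" where
  "centred_matrix R =
     column_symbol_matrix R -
     (real (dim_row R) / real (dim_col R)) \<cdot>\<^sub>m
       (ones_col (dim_col R) * transpose_mat (ones_col (dim_col R)))"

definition mat_trace :: "'a :: comm_monoid_add mat \<Rightarrow> 'a" where
  "mat_trace A = (\<Sum>i<dim_row A. A $$ (i, i))"

definition overlap :: "nat mat \<Rightarrow> nat \<Rightarrow> nat \<Rightarrow> nat" where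
  "overlap R a b = card (column_symbols R a \<inter> column_symbols R b)"

end

theory Submission
  imports Defs
begin

text \<open>
  Cyclicity of the trace turns \<open>tr ((C\<^sup>T C)\<^sup>2)\<close> into the sum of the squared entries of the Gram
  matrix \<open>C C\<^sup>T\<close> of the rows of \<open>C\<close> (lemma \<open>trace_gram_square\<close>); these rows belong to the
  columns of the rectangle. Every column contains exactly \<open>m\<close> symbols, so centring lowers each
  inner product of rows by \<open>m\<^sup>2 / n\<close>: the Gram matrix has the entries \<open>m - m\<^sup>2 / n = m d / n\<close> on
  its diagonal and \<open>c\<^sub>a\<^sub>b - m\<^sup>2 / n\<close> off it (lemma \<open>centred_row_product\<close>).

  Every symbol also lies in exactly \<open>m\<close> columns. Double counting then gives \<open>m (m - 1)\<close> for the
  sum of \<open>c\<^sub>a\<^sub>b\<close> over \<open>b \<noteq> a\<close> (lemma \<open>sum_overlap\<close>), so for each fixed \<open>a\<close> the number \<open>cbar\<close> is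
  the mean of these \<open>n - 1\<close> overlaps. The sum of squares about \<open>m\<^sup>2 / n\<close> therefore exceeds the sum
  of squares about \<open>cbar\<close> by \<open>(n - 1) (cbar - m\<^sup>2 / n)\<^sup>2\<close>, where
  \<open>cbar - m\<^sup>2 / n = - m d / (n (n - 1))\<close>. Together with its diagonal entry, row \<open>a\<close> contributes the
  excess \<open>m\<^sup>2 d\<^sup>2 / n\<^sup>2 + m\<^sup>2 d\<^sup>2 / (n\<^sup>2 (n - 1)) = m\<^sup>2 d\<^sup>2 / (n (n - 1))\<close>, and there are \<open>n\<close> rows.
\<close>

text \<open>
  Both sides are the sum over all \<open>a\<close>, \<open>b\<close>, \<open>s\<close>, \<open>t\<close> of the product of the four corners of the
  submatrix with rows \<open>a\<close>, \<open>b\<close> and columns \<open>s\<close>, \<open>t\<close>, so it suffices to reorder the summations.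
\<close>

lemma trace_gram_square:
  fixes A :: "'a :: comm_ring_1 mat"
  assumes A: "A \<in> carrier_mat p q"
  shows "mat_trace ((transpose_mat A * A) ^\<^sub>m 2) =
    (\<Sum>a<p. \<Sum>b<p. (\<Sum>s<q. A $$ (a, s) * A $$ (b, s))\<^sup>2)"
proof -
  define G where "G = transpose_mat A * A"
  have G: "G \<in> carrier_mat q q"
    using A by (simp add: G_def)
  have entry: "G $$ (s, t) = (\<Sum>a<p. A $$ (a, s) * A $$ (a, t))" if "s < q" "t < q" for s t
    using A that by (simp add: G_def scalar_prod_def lessThan_atLeast0)
  have rotate: "(\<Sum>t<q. \<Sum>a<p. \<Sum>b<p. f t a b) = (\<Sum>a<p. \<Sum>b<p. \<Sum>t<q. f t a b)"
    for f :: "nat \<Rightarrow> nat \<Rightarrow> nat \<Rightarrow> 'a"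
    by (rule trans[OF sum.swap]) (rule sum.cong[OF refl sum.swap])
  have "mat_trace (G ^\<^sub>m 2) = (\<Sum>s<q. \<Sum>t<q. G $$ (s, t) * G $$ (t, s))"
    using G by (simp add: mat_trace_def numeral_2_eq_2 scalar_prod_def lessThan_atLeast0)
  also have "\<dots> = (\<Sum>s<q. \<Sum>t<q. \<Sum>a<p. \<Sum>b<p.
      (A $$ (a, s) * A $$ (b, s)) * (A $$ (a, t) * A $$ (b, t)))"
    by (intro sum.cong refl) (simp add: entry sum_product mult_ac)
  also have "\<dots> = (\<Sum>s<q. \<Sum>a<p. \<Sum>b<p. \<Sum>t<q.
      (A $$ (a, s) * A $$ (b, s)) * (A $$ (a, t) * A $$ (b, t)))"
    by (simp only: rotate)
  also have "\<dots> = (\<Sum>a<p. \<Sum>b<p. \<Sum>s<q. \<Sum>t<q.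
      (A $$ (a, s) * A $$ (b, s)) * (A $$ (a, t) * A $$ (b, t)))"
    by (rule rotate)
  finally show ?thesis
    by (simp add: G_def power2_eq_square sum_product)
qed

lemma sum_squares_about_mean:
  fixes f :: "'a \<Rightarrow> real"
  assumes mean: "sum f B = real (card B) * \<mu>"
  shows "(\<Sum>b\<in>B. (f b - t)\<^sup>2) = (\<Sum>b\<in>B. (f b - \<mu>)\<^sup>2) + real (card B) * (\<mu> - t)\<^sup>2"
proof -
  have "(\<Sum>b\<in>B. (f b - t)\<^sup>2) =
      (\<Sum>b\<in>B. (f b - \<mu>)\<^sup>2 + 2 * (\<mu> - t) * (f b - \<mu>) + (\<mu> - t)\<^sup>2)"
    by (intro sum.cong refl) (simp add: power2_eq_square algebra_simps)
  also have "\<dots> = (\<Sum>b\<in>B. (f b - \<mu>)\<^sup>2) + 2 * (\<mu> - t) * (\<Sum>b\<in>B. f b - \<mu>)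
      + real (card B) * (\<mu> - t)\<^sup>2"
    by (simp add: sum.distrib sum_distrib_left)
  also have "(\<Sum>b\<in>B. f b - \<mu>) = 0"
    using mean by (simp add: sum_subtractf)
  finally show ?thesis by simp
qed

lemma latin_rectangle_dims:
  assumes "latin_rectangle m n R"
  shows "dim_row R = m" "dim_col R = n"
  using assms by (auto simp: latin_rectangle_def)

lemma column_symbols_subset:
  assumes "latin_rectangle m n R" "c < n"
  shows "column_symbols R c \<subseteq> {1..n}"
  using assms by (auto simp: latin_rectangle_def column_symbols_def dest!: bij_betw_apply)

lemma card_column_symbols:
  assumes "latin_rectangle m n R" "c < n"
  shows "card (column_symbols R c) = m"
proof -
  have "column_symbols R c = (\<lambda>r. R $$ (r, c)) ` {..<m}"
    using assms by (auto simp: latin_rectangle_def column_symbols_def)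
  with assms show ?thesis
    by (simp add: latin_rectangle_def card_image)
qed

text \<open>
  A symbol occurs exactly once in each row, and two of its occurrences never share a column, so
  sending a row to the position of the symbol in it is a bijection onto the columns containing it.
\<close>

lemma card_columns_containing:
  assumes R: "latin_rectangle m n R" and x: "x \<in> {1..n}"
  shows "card {c. c < n \<and> x \<in> column_symbols R c} = m"
proof -
  define pos where "pos r = inv_into {..<n} (\<lambda>c. R $$ (r, c)) x" for r
  have row: "bij_betw (\<lambda>c. R $$ (r, c)) {..<n} {1..n}" if "r < m" for r
    using R that by (simp add: latin_rectangle_def)
  have dim: "dim_row R = m"
    using latin_rectangle_dims[OF R] by simp
  have pos_less: "pos r < n" if "r < m" for r
    using bij_betw_apply[OF bij_betw_inv_into[OF row[OF that]] x] by (simp add: pos_def)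
  have R_pos: "R $$ (r, pos r) = x" if "r < m" for r
    using bij_betw_inv_into_right[OF row[OF that] x] by (simp add: pos_def)
  have pos_unique: "pos r = c" if "r < m" "c < n" "R $$ (r, c) = x" for r c
    using bij_betw_inv_into_left[OF row[OF that(1)], of c] that by (simp add: pos_def)
  have "bij_betw pos {..<m} {c. c < n \<and> x \<in> column_symbols R c}"
    unfolding bij_betw_def
  proof
    show "inj_on pos {..<m}"
    proof (rule inj_onI)
      fix r r' assume r: "r \<in> {..<m}" "r' \<in> {..<m}" and eq: "pos r = pos r'"
      have "inj_on (\<lambda>r. R $$ (r, pos r')) {..<m}"
        using R pos_less r by (simp add: latin_rectangle_def)
      moreover have "R $$ (r, pos r') = R $$ (r', pos r')"
        using R_pos[of r] R_pos[of r'] r eq by simp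
      ultimately show "r = r'"
        using r by (rule inj_onD)
    qed
    show "pos ` {..<m} = {c. c < n \<and> x \<in> column_symbols R c}"
    proof (intro equalityI subsetI)
      fix c assume "c \<in> pos ` {..<m}"
      then show "c \<in> {c. c < n \<and> x \<in> column_symbols R c}"
        using pos_less R_pos dim by (force simp: column_symbols_def)
    next
      fix c assume c: "c \<in> {c. c < n \<and> x \<in> column_symbols R c}"
      then obtain r where "r < m" "R $$ (r, c) = x"
        using dim by (auto simp: column_symbols_def)
      with c pos_unique show "c \<in> pos ` {..<m}" by force
    qed
  qed
  then show ?thesis
    by (metis bij_betw_same_card card_lessThan)
qed

text \<open>
  Count the pairs of a symbol \<open>x\<close> of column \<open>a\<close> and a column \<open>b\<close> containing \<open>x\<close>: there are \<open>m\<close>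
  choices of \<open>x\<close> and then \<open>m\<close> of \<open>b\<close>. The case \<open>b = a\<close> accounts for \<open>m\<close> of these \<open>m\<^sup>2\<close> pairs.
\<close>

lemma sum_overlap:
  assumes R: "latin_rectangle m n R" and a: "a < n"
  shows "(\<Sum>b\<in>{..<n} - {a}. real (overlap R a b)) = real m * (real m - 1)"
proof -
  let ?S = "column_symbols R"
  have Sa: "?S a \<subseteq> {1..n}" "card (?S a) = m"
    using column_symbols_subset[OF R a] card_column_symbols[OF R a] by auto
  then have fin: "finite (?S a)"
    by (meson finite_atLeastAtMost finite_subset)
  have "(\<Sum>b<n. overlap R a b) = (\<Sum>b<n. \<Sum>x\<in>?S a. if x \<in> ?S b then 1 else 0)"
    using fin by (simp add: overlap_def sum.inter_restrict[symmetric])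
  also have "\<dots> = (\<Sum>x\<in>?S a. \<Sum>b<n. if x \<in> ?S b then 1 else 0)"
    by (rule sum.swap)
  also have "\<dots> = (\<Sum>x\<in>?S a. card {b. b < n \<and> x \<in> ?S b})"
    by (simp add: sum.inter_filter[symmetric])
  also have "\<dots> = (\<Sum>x\<in>?S a. m)"
    using Sa(1) card_columns_containing[OF R] by (intro sum.cong) auto
  finally have "(\<Sum>b<n. overlap R a b) = m * m"
    using Sa(2) by simp
  then have "(\<Sum>b<n. real (overlap R a b)) = real m * real m"
    by (metis of_nat_mult of_nat_sum)
  moreover have "overlap R a a = m"
    using Sa(2) by (simp add: overlap_def)
  ultimately show ?thesis
    using a by (simp add: sum_diff1 right_diff_distrib)
qed

lemma centred_matrix_index:
  assumes "latin_rectangle m n R" "c < n" "s < n"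
  shows "centred_matrix R $$ (c, s) =
    (if Suc s \<in> column_symbols R c then 1 else 0) - real m / real n"
  using assms latin_rectangle_dims[OF assms(1)]
  by (simp add: centred_matrix_def column_symbol_matrix_def ones_col_def
      scalar_prod_def)

lemma centred_row_product:
  assumes R: "latin_rectangle m n R" and a: "a < n" and b: "b < n"
  shows "(\<Sum>s<n. centred_matrix R $$ (a, s) * centred_matrix R $$ (b, s)) =
    real (overlap R a b) - (real m)\<^sup>2 / real n"
proof -
  \<comment> \<open>The \<open>s\<close>-th matrix column belongs to the symbol \<open>Suc s\<close>, whence the shift of indices.\<close>
  have count: "(\<Sum>s<n. if Suc s \<in> T then 1 else 0) = real (card T)" if "T \<subseteq> {1..n}" for T
  proof -
    have "(\<Sum>s<n. if Suc s \<in> T then 1 else 0) = (\<Sum>x\<in>{1..n}. if x \<in> T then 1 else (0 :: real))"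
      by (rule sum.reindex_bij_witness[of _ "\<lambda>x. x - 1" Suc]) auto
    also have "\<dots> = real (card ({1..n} \<inter> T))"
      by (simp add: sum.inter_restrict[symmetric])
    finally show ?thesis
      using that by (simp add: Int_absorb1)
  qed
  let ?S = "column_symbols R"
  let ?\<chi> = "\<lambda>T s. if Suc s \<in> T then 1 else (0 :: real)"
  have n: "real n \<noteq> 0" using a by simp
  have sub: "?S a \<subseteq> {1..n}" "?S b \<subseteq> {1..n}" "?S a \<inter> ?S b \<subseteq> {1..n}"
    using column_symbols_subset[OF R] a b by auto
  have "(\<Sum>s<n. centred_matrix R $$ (a, s) * centred_matrix R $$ (b, s)) =
      (\<Sum>s<n. ?\<chi> (?S a \<inter> ?S b) s - real m / real n * ?\<chi> (?S a) s
        - real m / real n * ?\<chi> (?S b) s + (real m / real n)\<^sup>2)"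
    by (intro sum.cong refl)
      (auto simp: centred_matrix_index[OF R] a b power2_eq_square algebra_simps)
  also have "\<dots> = real (card (?S a \<inter> ?S b)) - real m / real n * real (card (?S a))
      - real m / real n * real (card (?S b)) + real n * (real m / real n)\<^sup>2"
    unfolding sum.distrib sum_subtractf sum_distrib_left[symmetric] count[OF sub(1)]
      count[OF sub(2)] count[OF sub(3)] by simp
  also have "\<dots> = real (overlap R a b) - (real m)\<^sup>2 / real n"
    using n by (simp add: card_column_symbols[OF R] a b overlap_def power2_eq_square field_simps)
  finally show ?thesis .
qed

theorem lemma5p1:
  fixes m n d :: nat and R :: "nat mat" and C :: "real mat" and cbar :: real
  assumes "2 \<le> n" and "m \<le> n" and "d = n - m"
    and "latin_rectangle m n R"
    and "C = centred_matrix R"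
    and "cbar = real m * (real m - 1) / (real n - 1)"
  shows "mat_trace ((transpose_mat C * C) ^\<^sub>m 2) =
    (\<Sum>(a, b) \<in> {(a, b). a < n \<and> b < n \<and> a \<noteq> b}. (real (overlap R a b) - cbar)\<^sup>2)
      + (real m)\<^sup>2 * (real d)\<^sup>2 / (real n - 1)"
proof -
  note R = assms(4)
  let ?c = "\<lambda>a b. real (overlap R a b)"
  let ?t = "(real m)\<^sup>2 / real n"
  have n: "real n \<noteq> 0" "real n - 1 \<noteq> 0" and d: "real d = real n - real m"
    using assms(1-3) by auto
  have C: "C \<in> carrier_mat n n"
    using R unfolding assms(5) centred_matrix_def column_symbol_matrix_def ones_col_def
    by (auto simp: latin_rectangle_def)
  have shift: "cbar - ?t = - (real m * real d) / (real n * (real n - 1))"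
    using n by (simp add: assms(6) d field_simps power2_eq_square)
  have row: "(\<Sum>b<n. (?c a b - ?t)\<^sup>2) =
      (\<Sum>b\<in>{..<n} - {a}. (?c a b - cbar)\<^sup>2) + (real m)\<^sup>2 * (real d)\<^sup>2 / (real n * (real n - 1))"
    if a: "a < n" for a
  proof -
    have card: "real (card ({..<n} - {a})) = real n - 1"
      using a by (simp add: of_nat_diff)
    have mean: "(\<Sum>b\<in>{..<n} - {a}. ?c a b) = real (card ({..<n} - {a})) * cbar"
      using n unfolding card by (simp add: sum_overlap[OF R a] assms(6))
    have diag: "?c a a - ?t = real m * real d / real n"
      using n card_column_symbols[OF R a]
      by (simp add: overlap_def d field_simps power2_eq_square)
    have "(\<Sum>b<n. (?c a b - ?t)\<^sup>2) =
        (?c a a - ?t)\<^sup>2 + (\<Sum>b\<in>{..<n} - {a}. (?c a b - ?t)\<^sup>2)"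
      using a by (simp add: sum.remove)
    also have "\<dots> = (real m * real d / real n)\<^sup>2 + (\<Sum>b\<in>{..<n} - {a}. (?c a b - cbar)\<^sup>2)
        + (real n - 1) * (- (real m * real d) / (real n * (real n - 1)))\<^sup>2"
      using sum_squares_about_mean[OF mean, of ?t] by (simp only: diag shift card add.assoc)
    also have "\<dots> = (\<Sum>b\<in>{..<n} - {a}. (?c a b - cbar)\<^sup>2)
        + (real m)\<^sup>2 * (real d)\<^sup>2 / (real n * (real n - 1))"
    proof -
      have "x\<^sup>2 / k\<^sup>2 + (k - 1) * (x\<^sup>2 / (k\<^sup>2 * (k - 1)\<^sup>2)) = x\<^sup>2 / (k * (k - 1))"
        if "k \<noteq> 0" "k - 1 \<noteq> 0" for x k :: real
        using that by (simp add: divide_simps power2_eq_square) (simp add: algebra_simps)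
      from this[OF n, of "real m * real d"] show ?thesis
        by (simp add: power_mult_distrib power_divide)
    qed
    finally show ?thesis .
  qed
  have "mat_trace ((transpose_mat C * C) ^\<^sub>m 2) = (\<Sum>a<n. \<Sum>b<n. (?c a b - ?t)\<^sup>2)"
    unfolding trace_gram_square[OF C] unfolding assms(5)
    by (intro sum.cong refl) (simp add: centred_row_product[OF R])
  also have "\<dots> = (\<Sum>a<n. \<Sum>b\<in>{..<n} - {a}. (?c a b - cbar)\<^sup>2)
      + real n * ((real m)\<^sup>2 * (real d)\<^sup>2 / (real n * (real n - 1)))"
    by (simp add: row sum.distrib)
  also have "(\<Sum>a<n. \<Sum>b\<in>{..<n} - {a}. (?c a b - cbar)\<^sup>2) =
      (\<Sum>(a, b)\<in>(SIGMA a:{..<n}. {..<n} - {a}). (?c a b - cbar)\<^sup>2)"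
    by (rule sum.Sigma) auto
  also have "(SIGMA a:{..<n}. {..<n} - {a}) = {(a, b). a < n \<and> b < n \<and> a \<noteq> b}"
    by auto
  finally show ?thesis
    using n by simp
qed

end
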